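(* Let $f:[0,1]\times\mathbb{R}^2\to\mathbb{R}$ be continuous and consider the periodic boundary value problem $$-x''=f(t,x,x')\quad (t\in[0,1]),\qquad x(0)=x(1),\quad x'(0)=x'(1). \qquad (P)$$ Suppose that $f=f_1+f_2$ with $f_1,f_2:[0,1]\times\mathbb{R}^2\to\mathbb{R}$. Suppose that $(P)$ has a lower solution $\alpha$ and an upper solution $\beta$ with $\alpha(t)\le\beta(t)$ for $t\in[0,1]$, $\alpha'(0)-\alpha'(1)\ge0$ and $\beta'(1)-\beta'(0)\ge0$, and that there are constants $\mu>0$ and $\ell>0$ such that $$|f(t,x_1,y_1)-f(t,x_2,y_2)|\le\ell|x_1-x_2|+\ell|y_1-y_2|$$ whenever $(t,x_i,y_i)\in G_{\alpha,\mu}$ for $i=1,2$, or $(t,x_i,y_i)\in G_{\beta,\mu}$ for $i=1,2$. Let $\Gamma=\{(t,x):\ t\in[0,1],\ \alpha(t)\le x\le\beta(t)\}$. If there are a function $c(t)\in C[0,1]$ and a constant $c<1$ with $c(t)(\beta(t)-\alpha(t))\le c$ for all $t\in[0,1]$ such that one of the following conditions is satisfied: (1) $\limsup_{|y|\to\infty}\dfrac{y f_1(t,x,y)}{|y|^3}\le c(t)$ uniformly on $\Gamma$, and $f_2(t,x,y)$ is nonincreasing in $y$ for each $(t,x)\in\Gamma$; (2) $\liminf_{|y|\to\infty}\dfrac{y f_1(t,x,y)}{|y|^3}\ge -c(t)$ uniformly on $\Gamma$, and $f_2(t,x,y)$ is nondecreasing in $y$ for each $(t,x)\in\Gamma$;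 then problem $(P)$ has a solution $x(t)$ satisfying $\alpha(t)\le x(t)\le\beta(t)$ for all $t\in[0,1]$.
   Context: A function $\alpha\in C^2[0,1]$ is a lower solution of $(P)$ if $-\alpha''(t)\le f(t,\alpha(t),\alpha'(t))$ for $t\in[0,1]$ and $\alpha(0)=\alpha(1)$. A function $\beta\in C^2[0,1]$ is an upper solution of $(P)$ if $-\beta''(t)\ge f(t,\beta(t),\beta'(t))$ for $t\in[0,1]$ and $\beta(0)=\beta(1)$. For $\gamma\in C^1[0,1]$ and $\mu>0$, $$G_{\gamma,\mu}=\{(t,x,y)\in\mathbb{R}^3:\ t\in[0,1],\ \gamma(t)-\mu\le x\le\gamma(t)+\mu,\ \gamma'(t)-\mu\le y\le\gamma'(t)+\mu\}.$$ "$\limsup_{|y|\to\infty}g(t,x,y)\le c(t)$ uniformly on $\Gamma$" means: for every $\varepsilon>0$ there is $y_0>0$ such that $g(t,x,y)\le c(t)+\varepsilon$ for all $(t,x)\in\Gamma$ and all $|y|>y_0$; the uniform $\liminf$ inequality is understood analogously. *)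

theory Defs
  imports "HOL-Analysis.Analysis"
begin

text \<open>
  Functions on \<open>[0,1]\<close> are total functions on the reals of which only the values
  on \<open>{0..1}\<close> matter; derivatives are taken within \<open>{0..1}\<close>, so they are one-sided
  at the endpoints.
\<close>

definition deriv01 :: "(real \<Rightarrow> real) \<Rightarrow> real \<Rightarrow> real" where
  "deriv01 u t = vector_derivative u (at t within {0..1})"

definition C1_01 :: "(real \<Rightarrow> real) \<Rightarrow> bool" where
  "C1_01 u \<longleftrightarrow>
     (\<forall>t\<in>{0..1}. u differentiable (at t within {0..1})) \<and> continuous_on {0..1} (deriv01 u)"

definition C2_01 :: "(real \<Rightarrow> real) \<Rightarrow> bool" where
  "C2_01 u \<longleftrightarrow> C1_01 u \<and> C1_01 (deriv01 u)"

definition lower_solution :: "(real \<Rightarrow> real \<Rightarrow> real \<Rightarrow> real) \<Rightarrow> (real \<Rightarrow> real) \<Rightarrow> bool" where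
  "lower_solution f \<alpha> \<longleftrightarrow> C2_01 \<alpha> \<and>
     (\<forall>t\<in>{0..1}. - deriv01 (deriv01 \<alpha>) t \<le> f t (\<alpha> t) (deriv01 \<alpha> t)) \<and> \<alpha> 0 = \<alpha> 1"

definition upper_solution :: "(real \<Rightarrow> real \<Rightarrow> real \<Rightarrow> real) \<Rightarrow> (real \<Rightarrow> real) \<Rightarrow> bool" where
  "upper_solution f \<beta> \<longleftrightarrow> C2_01 \<beta> \<and>
     (\<forall>t\<in>{0..1}. - deriv01 (deriv01 \<beta>) t \<ge> f t (\<beta> t) (deriv01 \<beta> t)) \<and> \<beta> 0 = \<beta> 1"

definition periodic_solution :: "(real \<Rightarrow> real \<Rightarrow> real \<Rightarrow> real) \<Rightarrow> (real \<Rightarrow> real) \<Rightarrow> bool" where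
  "periodic_solution f x \<longleftrightarrow> C2_01 x \<and>
     (\<forall>t\<in>{0..1}. - deriv01 (deriv01 x) t = f t (x t) (deriv01 x t)) \<and>
     x 0 = x 1 \<and> deriv01 x 0 = deriv01 x 1"

definition G_set :: "(real \<Rightarrow> real) \<Rightarrow> real \<Rightarrow> (real \<times> real \<times> real) set" where
  "G_set \<gamma> \<mu> = {(t, x, y). t \<in> {0..1} \<and> \<gamma> t - \<mu> \<le> x \<and> x \<le> \<gamma> t + \<mu> \<and>
     deriv01 \<gamma> t - \<mu> \<le> y \<and> y \<le> deriv01 \<gamma> t + \<mu>}"

definition Gamma_set :: "(real \<Rightarrow> real) \<Rightarrow> (real \<Rightarrow> real) \<Rightarrow> (real \<times> real) set" where
  "Gamma_set \<alpha> \<beta> = {(t, x). t \<in> {0..1} \<and> \<alpha> t \<le> x \<and> x \<le> \<beta> t}"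

definition unif_limsup_le ::
  "(real \<times> real) set \<Rightarrow> (real \<Rightarrow> real \<Rightarrow> real \<Rightarrow> real) \<Rightarrow> (real \<Rightarrow> real) \<Rightarrow> bool" where
  "unif_limsup_le \<Gamma> g c \<longleftrightarrow>
     (\<forall>\<epsilon>>0. \<exists>y0>0. \<forall>(t, x)\<in>\<Gamma>. \<forall>y. \<bar>y\<bar> > y0 \<longrightarrow> g t x y \<le> c t + \<epsilon>)"

definition unif_liminf_ge ::
  "(real \<times> real) set \<Rightarrow> (real \<Rightarrow> real \<Rightarrow> real \<Rightarrow> real) \<Rightarrow> (real \<Rightarrow> real) \<Rightarrow> bool" where
  "unif_liminf_ge \<Gamma> g c \<longleftrightarrow>
     (\<forall>\<epsilon>>0. \<exists>y0>0. \<forall>(t, x)\<in>\<Gamma>. \<forall>y. \<bar>y\<bar> > y0 \<longrightarrow> g t x y \<ge> c t - \<epsilon>)"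

end

theory Submission imports Defs "HOL-Complex_Analysis.Great_Picard" begin

text \<open>Truncating \<open>x\<close> to the strip between \<open>\<alpha>\<close> and \<open>\<beta>\<close> and \<open>x'\<close> to \<open>[- R, R]\<close>
  turns the equation into \<open>x'' = x - F(t, x, x')\<close> with bounded \<open>F\<close>. In the coordinates
  \<open>u = x + x'\<close>, \<open>v = x - x'\<close> its linear part is diagonal, so the Euler scheme of step \<open>1/N\<close> has a
  periodic orbit by Brouwer's theorem, and a uniform limit of these orbits solves the truncated
  problem. A minimum principle at negative minima of \<open>x - \<alpha>\<close> and \<open>\<beta> - x\<close> keeps \<open>x\<close> in the strip.
  Either growth condition, together with the monotonicity of \<open>f2\<close>, bounds \<open>f\<close> by
  \<open>C x'\<^sup>2 + K\<close> from the side that is needed for a Nagumo estimate along an orbit (run backwards in time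
  in the second case), so \<open>\<bar>x'\<bar> < R\<close> for large \<open>R\<close> and the truncation is inactive.\<close>

section \<open>Polygonal interpolation and limits of Euler polygons\<close>

text \<open>The piecewise linear interpolant of \<open>w k\<close> at the nodes k/N, written as one
  sum with clamped weights: no case distinction on the cell that contains \<open>t\<close> is
  needed, and increments become weighted sums of the steps \<open>w (Suc k) - w k\<close>.\<close>

definition polygon :: "nat \<Rightarrow> (nat \<Rightarrow> 'a::real_vector) \<Rightarrow> real \<Rightarrow> 'a" where
  "polygon N w t = w 0 + (\<Sum>k<N. max 0 (min 1 (real N * t - real k)) *\<^sub>R (w (Suc k) - w k))"

text \<open>The k-th summand is the length of the part of [0, a] that lies in [k, k + 1].\<close>

lemma sum_clamp:
  assumes "0 \<le> a"
  shows "(\<Sum>k<n. max 0 (min 1 (a - real k))) = min a (real n)"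
  using assms by (induction n) (auto simp: min_def max_def)

lemma polygon_node:
  assumes "j \<le> N" "N > 0"
  shows "polygon N w (real j / real N) = w j"
proof -
  have "(\<Sum>k<N. max 0 (min 1 (real N * (real j / real N) - real k)) *\<^sub>R (w (Suc k) - w k))
      = (\<Sum>k<N. if k < j then w (Suc k) - w k else 0)"
    using assms by (intro sum.cong refl) (auto simp: max_def min_def)
  also have "\<dots> = (\<Sum>k<j. w (Suc k) - w k)"
    using assms by (intro sum.mono_neutral_cong_right) auto
  also have "\<dots> = w j - w 0"
    by (rule sum_lessThan_telescope)
  finally show ?thesis by (simp add: polygon_def)
qed

text \<open>Up to the factor \<open>t - s\<close>, the increment over [s, t] is a weighted mean of
  the slopes \<open>G k\<close> on the cells that meet [s, t]. The bound s - 1/N on the nodes admits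
  the cell that contains \<open>s\<close>, whose left node may precede \<open>s\<close>.\<close>

lemma polygon_increment:
  fixes w :: "nat \<Rightarrow> 'a::real_normed_vector"
  assumes N: "N > 0" and st: "0 \<le> s" "s \<le> t" "t \<le> 1"
    and step: "\<And>k. k < N \<Longrightarrow> w (Suc k) - w k = (1 / real N) *\<^sub>R G k"
    and G: "\<And>k. k < N \<Longrightarrow> s - 1 / real N < real k / real N \<Longrightarrow> real k / real N < t \<Longrightarrow> norm (G k - v) \<le> e"
  shows "norm (polygon N w t - polygon N w s - (t - s) *\<^sub>R v) \<le> (t - s) * e"
proof -
  define c where "c = (\<lambda>a k. max 0 (min 1 (real N * a - real k)))"
  define d where "d = (\<lambda>k. (c t k - c s k) / real N)"
  have mono: "real N * s \<le> real N * t" using st by (simp add: mult_left_mono)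
  have d0: "d k \<ge> 0" for k
    using mono by (auto simp: d_def c_def intro!: divide_nonneg_nonneg max.mono min.mono)
  have sumc: "(\<Sum>k<N. c a k) = real N * a" if "0 \<le> a" "a \<le> 1" for a
  proof -
    have "(\<Sum>k<N. c a k) = min (real N * a) (real N)"
      unfolding c_def using that by (intro sum_clamp) simp
    then show ?thesis using that by (simp add: min_def mult_left_le)
  qed
  have sumd: "(\<Sum>k<N. d k) = t - s"
    using sumc[of s] sumc[of t] st N
    by (simp add: d_def sum_divide_distrib[symmetric] sum_subtractf field_simps)
  have "polygon N w t - polygon N w s = (\<Sum>k<N. (c t k - c s k) *\<^sub>R (w (Suc k) - w k))"
    by (simp add: polygon_def c_def sum_subtractf scaleR_diff_left)
  also have "\<dots> = (\<Sum>k<N. d k *\<^sub>R G k)"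
    by (intro sum.cong) (auto simp: step d_def)
  finally have "polygon N w t - polygon N w s - (t - s) *\<^sub>R v = (\<Sum>k<N. d k *\<^sub>R (G k - v))"
    by (simp add: sumd[symmetric] scaleR_sum_left sum_subtractf scaleR_diff_right)
  also have "norm \<dots> \<le> (\<Sum>k<N. d k * e)"
  proof (rule sum_norm_le)
    fix k assume k: "k \<in> {..<N}"
    show "norm (d k *\<^sub>R (G k - v)) \<le> d k * e"
    proof (cases "d k = 0")
      case False
      then have "c t k \<noteq> c s k" by (auto simp: d_def)
      \<comment> \<open>A cell beyond \<open>t\<close> has both clamped weights 0, a cell before
        \<open>s\<close> has both equal to 1; neither contributes to the increment.\<close>
      moreover have "c t k = c s k" if "real N * t \<le> real k \<or> real k \<le> real N * s - 1"
        using that mono by (auto simp: c_def)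
      ultimately have "real k < real N * t" "real N * s - 1 < real k"
        by force+
      then have "real k / real N < t" "(real N * s - 1) / real N < real k / real N"
        using N by (simp_all add: divide_strict_right_mono pos_divide_less_eq mult.commute)
      then have "norm (G k - v) \<le> e"
        using N k by (intro G) (auto simp: diff_divide_distrib)
      then show ?thesis using d0[of k] by (simp add: mult_left_mono)
    qed simp
  qed
  also have "\<dots> = (t - s) * e" by (simp add: sumd sum_distrib_right[symmetric])
  finally show ?thesis .
qed

text \<open>Peano's argument: the common bound \<open>R\<close> makes the Euler polygons uniformly
  Lipschitz, Arzela-Ascoli gives a uniform limit, and \<open>polygon_increment\<close> passes to the
  limit as the differential equation. Periodicity survives pointwise convergence.\<close>

lemma euler_limit:
  fixes g :: "real \<Rightarrow> 'a::euclidean_space \<Rightarrow> 'a" and w :: "nat \<Rightarrow> nat \<Rightarrow> 'a"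
  assumes cont: "continuous_on ({0..1} \<times> UNIV) (\<lambda>(t, z). g t z)"
    and step: "\<And>N k. N > 0 \<Longrightarrow> k < N \<Longrightarrow> w N (Suc k) - w N k = (1 / real N) *\<^sub>R g (real k / real N) (w N k)"
    and bd: "\<And>N k. N > 0 \<Longrightarrow> k \<le> N \<Longrightarrow> norm (w N k) \<le> R"
    and per: "\<And>N. N > 0 \<Longrightarrow> w N N = w N 0"
  shows "\<exists>\<omega>. \<omega> 1 = \<omega> 0 \<and> (\<forall>t\<in>{0..1}. (\<omega> has_vector_derivative g t (\<omega> t)) (at t within {0..1}))"
proof -
  \<comment> \<open>\<open>L\<close> bounds all slopes at the nodes, so it is a Lipschitz constant
    shared by all polygons.\<close>
  have "compact ((\<lambda>(t, z). g t z) ` ({0..1} \<times> cball 0 R))"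
    by (intro compact_continuous_image continuous_on_subset[OF cont] compact_Times) auto
  then obtain L where L: "L > 0" "\<And>t z. t \<in> {0..1} \<Longrightarrow> norm z \<le> R \<Longrightarrow> norm (g t z) \<le> L"
    unfolding bounded_pos[THEN arg_cong] using compact_imp_bounded bounded_pos
    by (smt (verit) case_prod_conv imageI mem_Sigma_iff mem_cball_0)
  \<comment> \<open>Indexing by \<open>Suc n\<close> excludes step number 0.\<close>
  define P where "P = (\<lambda>n. polygon (Suc n) (w (Suc n)))"
  define G where "G = (\<lambda>n k. g (real k / real (Suc n)) (w (Suc n) k))"
  have inc: "norm (P n t - P n s - (t - s) *\<^sub>R v) \<le> (t - s) * e"
    if "0 \<le> s" "s \<le> t" "t \<le> 1" "\<And>k. k < Suc n \<Longrightarrow> s - 1 / real (Suc n) < real k / real (Suc n) \<Longrightarrow>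
       real k / real (Suc n) < t \<Longrightarrow> norm (G n k - v) \<le> e" for n s t v e
    unfolding P_def using that by (intro polygon_increment[where G = "G n"]) (auto simp: G_def step)
  have lip0: "norm (P n t - P n s) \<le> L * (t - s)" if "0 \<le> s" "s \<le> t" "t \<le> 1" for n s t
  proof -
    have "norm (G n k) \<le> L" if "k < Suc n" for k
      unfolding G_def using that by (intro L bd) (auto simp: field_simps)
    then show ?thesis using inc[of s t n 0 L] that by (simp add: mult.commute)
  qed
  have lip: "norm (P n t - P n s) \<le> L * \<bar>t - s\<bar>" if "s \<in> {0..1}" "t \<in> {0..1}" for n s t
    using lip0[of s t n] lip0[of t s n] that by (cases "s \<le> t") (auto simp: norm_minus_commute)
  have node: "P n (real k / real (Suc n)) = w (Suc n) k" if "k \<le> Suc n" for n k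
    unfolding P_def using that by (intro polygon_node) auto
  have P0: "norm (P n 0) \<le> R" "P n 1 = P n 0" for n
    using node[of 0 n] node[of "Suc n" n] bd[of "Suc n" 0] per[of "Suc n"] by auto
  have bnd: "norm (P n t) \<le> R + L" if "t \<in> {0..1}" for n t
  proof -
    have "norm (P n t) \<le> norm (P n 0) + norm (P n t - P n 0)" by norm
    also have "\<dots> \<le> R + L * 1"
      using lip[of 0 t n] P0(1)[of n] that L(1) mult_left_mono[of t 1 L]
      by (intro add_mono) (auto intro: order_trans)
    finally show ?thesis by simp
  qed
  have equi: "\<exists>d>0. \<forall>n y. y \<in> {0..1} \<and> norm (x - y) < d \<longrightarrow> norm (P n x - P n y) < e"
    if "x \<in> {0..1}" "e > 0" for x e
  proof (intro exI[of _ "e / L"] conjI allI impI)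
    fix n y assume y: "y \<in> {0..1} \<and> norm (x - y) < e / L"
    then have "norm (P n x - P n y) \<le> L * \<bar>x - y\<bar>" using lip that by blast
    also have "\<dots> < e" using y L(1) by (simp add: field_simps)
    finally show "norm (P n x - P n y) < e" .
  qed (use that L in auto)
  obtain \<omega> and r :: "nat \<Rightarrow> nat" where "continuous_on {0..1} \<omega>" and \<omega>: "strict_mono r"
    "\<And>e. 0 < e \<Longrightarrow> \<exists>N. \<forall>n x. n \<ge> N \<and> x \<in> {0..1} \<longrightarrow> norm (P (r n) x - \<omega> x) < e"
    by (rule Arzela_Ascoli[OF compact_Icc bnd equi]) blast+
  have conv: "(\<lambda>n. P (r n) x) \<longlonglongrightarrow> \<omega> x" if "x \<in> {0..1}" for x
    unfolding LIMSEQ_iff using \<omega>(2) that by meson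
  have "(\<lambda>n. P (r n) 0) \<longlonglongrightarrow> \<omega> 1" using conv[of 1] by (simp add: P0)
  then have per': "\<omega> 1 = \<omega> 0" using conv[of 0] LIMSEQ_unique by auto
  have "(\<omega> has_vector_derivative g t0 (\<omega> t0)) (at t0 within {0..1})" if t0: "t0 \<in> {0..1}" for t0
    unfolding has_vector_derivative_def has_derivative_within_alt
  proof (intro conjI allI impI bounded_linear_scaleR_left)
    fix e :: real assume e: "e > 0"
    define v where "v = g t0 (\<omega> t0)"
    obtain \<delta> where \<delta>: "\<delta> > 0" "\<And>s z. s \<in> {0..1} \<Longrightarrow> dist (s, z) (t0, \<omega> t0) < \<delta> \<Longrightarrow> dist (g s z) v < e"
      using cont[unfolded continuous_on_iff, rule_format, of "(t0, \<omega> t0)" e] t0 e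
      by (auto simp: v_def)
    have \<delta>2: "norm (g s z - v) \<le> e" if "s \<in> {0..1}" "\<bar>s - t0\<bar> < \<delta> / 2" "norm (z - \<omega> t0) < \<delta> / 2" for s z
    proof -
      have "dist (s, z) (t0, \<omega> t0) \<le> \<bar>s - t0\<bar> + norm (z - \<omega> t0)"
        unfolding dist_norm using norm_Pair_le[of "s - t0" "z - \<omega> t0"] by simp
      then show ?thesis using \<delta>(2)[of s z] that by (simp add: dist_norm)
    qed
    \<comment> \<open>A node that matters lies within \<open>d\<close> plus one mesh width, hence
      within \<open>2 * d\<close>, of \<open>t0\<close>. Over that distance a polygon moves by less
      than \<delta>/4, and the error of uniform convergence adds at most another \<delta>/4.\<close>
    define d where "d = \<delta> / (8 * (L + 1))"
    have "d > 0" using \<delta>(1) L(1) by (simp add: d_def)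
    moreover have "d * (L + 1) = \<delta> / 8" using L(1) by (simp add: d_def divide_simps)
    moreover have "d * L > 0" using \<open>d > 0\<close> L(1) by simp
    ultimately have d: "d > 0" "2 * d < \<delta> / 2" "L * (2 * d) < \<delta> / 4"
      by (auto simp: algebra_simps)
    obtain n0 where n0: "\<And>n x. n \<ge> n0 \<Longrightarrow> x \<in> {0..1} \<Longrightarrow> norm (P (r n) x - \<omega> x) < \<delta> / 4"
      using \<omega>(2)[OF divide_pos_pos[OF \<delta>(1) zero_less_numeral]] by blast
    obtain n1 :: nat where n1: "1 / real (Suc n1) < d"
      using d(1) nat_approx_posE by (metis)
    \<comment> \<open>Stated for ordered pairs near \<open>t0\<close>, so that it serves difference
      quotients on either side of \<open>t0\<close>, including the endpoints of the
      interval.\<close>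
    have main: "norm (\<omega> t - \<omega> s - (t - s) *\<^sub>R v) \<le> (t - s) * e"
      if "0 \<le> s" "s \<le> t" "t \<le> 1" "\<bar>s - t0\<bar> < d" "\<bar>t - t0\<bar> < d" for s t
    proof (rule tendsto_upperbound)
      show "(\<lambda>n. norm (P (r n) t - P (r n) s - (t - s) *\<^sub>R v)) \<longlonglongrightarrow> norm (\<omega> t - \<omega> s - (t - s) *\<^sub>R v)"
        using that by (intro tendsto_intros conv) auto
      show "\<forall>\<^sub>F n in sequentially. norm (P (r n) t - P (r n) s - (t - s) *\<^sub>R v) \<le> (t - s) * e"
        using eventually_ge_at_top[of "max n0 n1"]
      proof eventually_elim
        case (elim n)
        have "n1 \<le> r n" using elim seq_suble[OF \<omega>(1), of n] by linarith
        then have "1 / real (Suc (r n)) \<le> 1 / real (Suc n1)" by (simp add: frac_le)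
        then have small: "1 / real (Suc (r n)) < d" using n1 by linarith
        show ?case
        proof (rule inc)
          fix k assume k: "k < Suc (r n)" "s - 1 / real (Suc (r n)) < real k / real (Suc (r n))"
            "real k / real (Suc (r n)) < t"
          define \<tau> where "\<tau> = real k / real (Suc (r n))"
          have \<tau>: "\<tau> \<in> {0..1}" using k by (auto simp: \<tau>_def field_simps)
          have \<tau>2: "\<bar>\<tau> - t0\<bar> < 2 * d"
            using k small that unfolding \<tau>_def[symmetric] by linarith
          have "norm (P (r n) \<tau> - \<omega> t0) \<le> norm (P (r n) \<tau> - P (r n) t0) + norm (P (r n) t0 - \<omega> t0)"
            by norm
          also have "\<dots> < L * (2 * d) + \<delta> / 4"
            using lip[OF t0 \<tau>, of "r n"] n0[of n t0] elim t0 mult_strict_left_mono[OF \<tau>2 L(1)]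
            by linarith
          finally have "norm (P (r n) \<tau> - \<omega> t0) < \<delta> / 2" using d by linarith
          then have "norm (w (Suc (r n)) k - \<omega> t0) < \<delta> / 2"
            using node[of k "r n"] k by (simp add: \<tau>_def)
          then show "norm (G (r n) k - v) \<le> e"
            unfolding G_def \<tau>_def[symmetric] using \<tau> \<tau>2 d by (intro \<delta>2) auto
        qed (use that in auto)
      qed
    qed simp
    show "\<exists>d>0. \<forall>y\<in>{0..1}. norm (y - t0) < d \<longrightarrow>
        norm (\<omega> y - \<omega> t0 - (y - t0) *\<^sub>R g t0 (\<omega> t0)) \<le> e * norm (y - t0)"
    proof (intro exI[of _ d] conjI ballI impI)
      fix y assume y: "y \<in> {0..1::real}" "norm (y - t0) < d"
      show "norm (\<omega> y - \<omega> t0 - (y - t0) *\<^sub>R g t0 (\<omega> t0)) \<le> e * norm (y - t0)"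
      proof (cases "t0 \<le> y")
        case True
        then show ?thesis using main[of t0 y] y t0 d by (simp add: v_def mult.commute)
      next
        case False
        have "\<omega> y - \<omega> t0 - (y - t0) *\<^sub>R v = - (\<omega> t0 - \<omega> y - (t0 - y) *\<^sub>R v)"
          by (simp add: algebra_simps)
        then have "norm (\<omega> y - \<omega> t0 - (y - t0) *\<^sub>R v) = norm (\<omega> t0 - \<omega> y - (t0 - y) *\<^sub>R v)"
          by (simp only: norm_minus_cancel)
        then show ?thesis using False main[of y t0] y t0 d by (simp add: v_def mult.commute)
      qed
    qed (use d in auto)
  qed
  with per' show ?thesis by blast
qed

section \<open>Periodic orbits of the Euler scheme\<close>

primrec euler :: "(real \<Rightarrow> 'a \<Rightarrow> 'a) \<Rightarrow> real \<Rightarrow> nat \<Rightarrow> 'a \<Rightarrow> 'a::real_vector" where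
  "euler g h 0 z = z"
| "euler g h (Suc k) z = euler g h k z + h *\<^sub>R g (real k * h) (euler g h k z)"

text \<open>Continuity is asked only at the times j h with j < k that the scheme visits, because the
  right-hand side will be known to be continuous only for times in [0, 1].\<close>

lemma continuous_on_euler:
  fixes g :: "real \<Rightarrow> 'a::real_normed_vector \<Rightarrow> 'a"
  assumes "\<And>j. j < k \<Longrightarrow> continuous_on UNIV (g (real j * h))"
  shows "continuous_on S (euler g h k)"
  using assms
proof (induction k)
  case 0
  show ?case by (simp add: continuous_on_id)
next
  case (Suc k)
  have IH: "continuous_on S (euler g h k)"
    by (rule Suc.IH) (rule Suc.prems, simp)
  have "continuous_on S (\<lambda>z. g (real k * h) (euler g h k z))"
    by (rule continuous_on_compose2[OF Suc.prems[OF lessI] IH subset_UNIV])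
  then show ?case
    using IH by (simp add: continuous_on_add continuous_on_scaleR continuous_on_const)
qed

text \<open>For a bounded perturbation \<open>F\<close> of the decoupled linear system \<open>u' = u\<close>, \<open>v' = - v\<close>,
  the equation for an \<open>N\<close>-periodic Euler orbit is a fixed point equation that maps
  the square of half-width \<open>M\<close> to itself.\<close>

lemma euler_periodic_orbit:
  fixes F :: "real \<Rightarrow> real \<times> real \<Rightarrow> real"
  assumes N: "N > 0"
    and cont: "\<And>j. j < N \<Longrightarrow> continuous_on UNIV (F (real j * (1 / real N)))"
    and bd: "\<And>j z. j < N \<Longrightarrow> \<bar>F (real j * (1 / real N)) z\<bar> \<le> M"
  defines "g \<equiv> \<lambda>t z. (fst z - F t z, F t z - snd z)"
  defines "E \<equiv> euler g (1 / real N)"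
  shows "\<exists>z. E N z = z \<and> (\<forall>k\<le>N. \<bar>fst (E k z)\<bar> \<le> M \<and> \<bar>snd (E k z)\<bar> \<le> M)"
proof -
  define h where "h = 1 / real N"
  have h: "0 < h" "h \<le> 1" using N by (auto simp: h_def)
  have M: "M \<ge> 0" by (rule order_trans[OF abs_ge_zero bd[OF N, of 0]])
  define \<phi> where "\<phi> = (\<lambda>k z. F (real k * h) (E k z))"
  have \<phi>: "\<bar>\<phi> k z\<bar> \<le> M" if "k < N" for k z
    unfolding \<phi>_def h_def using that by (rule bd)
  have E0: "E 0 z = z" for z by (simp add: E_def)
  have fstE: "fst (E (Suc k) z) = (1 + h) * fst (E k z) - h * \<phi> k z"
    and sndE: "snd (E (Suc k) z) = (1 - h) * snd (E k z) + h * \<phi> k z" for k z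
    by (auto simp: E_def g_def \<phi>_def h_def algebra_simps)
  \<comment> \<open>The deviation e from the linear recursion starts at 0 and satisfies e(k+1) \<le>
    (1 + h) e(k) + h M, which sums to this bound. \<open>B\<close> is the analogue with the factor 1
    - h, nonnegative since h \<le> 1.\<close>
  have A: "\<bar>(1 + h) ^ k * fst z - fst (E k z)\<bar> \<le> M * ((1 + h) ^ k - 1)" if "k \<le> N" for k z
    using that
  proof (induction k)
    case (Suc k)
    have "(1 + h) ^ Suc k * fst z - fst (E (Suc k) z)
        = (1 + h) * ((1 + h) ^ k * fst z - fst (E k z)) + h * \<phi> k z"
      by (simp add: fstE algebra_simps)
    also have "\<bar>\<dots>\<bar> \<le> (1 + h) * (M * ((1 + h) ^ k - 1)) + h * M"
      using Suc \<phi>[of k z] h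
      by (intro order_trans[OF abs_triangle_ineq] add_mono) (auto simp: abs_mult intro!: mult_left_mono)
    finally show ?case by (simp add: algebra_simps)
  qed (simp add: E0)
  have B: "\<bar>snd (E k z) - (1 - h) ^ k * snd z\<bar> \<le> M * (1 - (1 - h) ^ k)" if "k \<le> N" for k z
    using that
  proof (induction k)
    case (Suc k)
    have "snd (E (Suc k) z) - (1 - h) ^ Suc k * snd z
        = (1 - h) * (snd (E k z) - (1 - h) ^ k * snd z) + h * \<phi> k z"
      by (simp add: sndE algebra_simps)
    also have "\<bar>\<dots>\<bar> \<le> (1 - h) * (M * (1 - (1 - h) ^ k)) + h * M"
      using Suc \<phi>[of k z] h
      by (intro order_trans[OF abs_triangle_ineq] add_mono) (auto simp: abs_mult intro!: mult_left_mono)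
    finally show ?case by (simp add: algebra_simps)
  qed (simp add: E0)
  have a: "(1 + h) ^ N > 1" using h N by (intro one_less_power) auto
  have b: "(1 - h) ^ N < 1"
  proof -
    have "(1 - h) ^ N \<le> (1 - h) ^ 1" using h N by (intro power_decreasing) auto
    then show ?thesis using h by simp
  qed
  \<comment> \<open>Multiplying out, T z = z says exactly that E N z = z. The denominators match the
    bounds \<open>A\<close> and \<open>B\<close>, so \<open>T\<close> maps the square
    \<open>Q\<close> to itself.\<close>
  define T where "T = (\<lambda>z. (((1 + h) ^ N * fst z - fst (E N z)) / ((1 + h) ^ N - 1),
                           (snd (E N z) - (1 - h) ^ N * snd z) / (1 - (1 - h) ^ N)))"
  define Q where "Q = {-M..M} \<times> {-M..M}"
  have contE: "continuous_on Q (E k)" if "k \<le> N" for k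
    unfolding E_def
  proof (rule continuous_on_euler)
    fix j assume "j < k"
    then show "continuous_on UNIV (g (real j * (1 / real N)))"
      unfolding g_def using that by (intro continuous_intros cont) auto
  qed
  obtain z where z: "z \<in> Q" "T z = z"
  proof (rule brouwer)
    show "compact Q" "convex Q" "Q \<noteq> {}"
      using M by (auto simp: Q_def intro!: compact_Times convex_Times)
    show "continuous_on Q T"
      unfolding T_def using a b by (intro continuous_intros contE) auto
    show "T \<in> Q \<rightarrow> Q"
    proof
      fix z assume "z \<in> Q"
      have "\<bar>fst (T z)\<bar> \<le> M" "\<bar>snd (T z)\<bar> \<le> M"
        using A[of N z] B[of N z] a b by (auto simp: T_def divide_le_eq mult.commute)
      then show "T z \<in> Q" by (auto simp: Q_def abs_le_iff mem_Times_iff)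
    qed
  qed
  have "fst (T z) = fst z" "snd (T z) = snd z" using z by auto
  then have "(1 + h) ^ N * fst z - fst (E N z) = fst z * ((1 + h) ^ N - 1)"
    "snd (E N z) - (1 - h) ^ N * snd z = snd z * (1 - (1 - h) ^ N)"
    using a b by (simp_all add: T_def nonzero_divide_eq_eq)
  then have fix1: "fst (E N z) = fst z" "snd (E N z) = snd z"
    by (simp_all add: algebra_simps)
  have zM: "\<bar>fst z\<bar> \<le> M" "\<bar>snd z\<bar> \<le> M" using z by (auto simp: Q_def)
  \<comment> \<open>The second component contracts, so its bound propagates forwards from k =
    0.\<close>
  have "\<bar>snd (E k z)\<bar> \<le> M" if "k \<le> N" for k
    using that
  proof (induction k)
    case (Suc k)
    have "\<bar>snd (E (Suc k) z)\<bar> \<le> (1 - h) * M + h * M"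
      unfolding sndE using Suc \<phi>[of k z] h
      by (intro order_trans[OF abs_triangle_ineq] add_mono) (auto simp: abs_mult intro!: mult_left_mono)
    then show ?case by (simp add: algebra_simps)
  qed (simp add: E0 zM)
  \<comment> \<open>The first component expands, so its bound propagates backwards, starting at k =
    N where periodicity returns the value at 0.\<close>
  moreover have "\<bar>fst (E k z)\<bar> \<le> M" if "k \<le> N" for k
    using that
  proof (induction rule: inc_induct)
    case (step k)
    have "\<bar>(1 + h) * fst (E k z)\<bar> = \<bar>fst (E (Suc k) z) + h * \<phi> k z\<bar>" by (simp add: fstE)
    also have "\<dots> \<le> M + h * M"
      using step \<phi>[of k z] h
      by (intro order_trans[OF abs_triangle_ineq] add_mono) (auto simp: abs_mult intro!: mult_left_mono)
    finally have "(1 + h) * \<bar>fst (E k z)\<bar> \<le> (1 + h) * M"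
      using h by (simp add: abs_mult algebra_simps)
    then show ?case using h by simp
  qed (simp add: fix1 zM)
  moreover have "E N z = z" using fix1 by (simp add: prod_eq_iff)
  ultimately show ?thesis by (intro exI[of _ z] conjI allI impI)
qed

section \<open>The periodic problem with bounded nonlinearity\<close>

text \<open>The linear part x'' = x has only the zero periodic solution, so a bounded
  \<open>F\<close> can be treated as a perturbation. With u = x + y and v = x - y the system reads
  u' = u - \<Phi>, v' = \<Phi> - v, and its discrete periodic orbits stay in a square independent of
  \<open>N\<close>, as \<open>euler_limit\<close> requires.\<close>

lemma bounded_periodic_bvp:
  fixes F :: "real \<Rightarrow> real \<Rightarrow> real \<Rightarrow> real"
  assumes cont: "continuous_on ({0..1} \<times> UNIV) (\<lambda>(t, x, y). F t x y)"
    and bd: "\<And>t x y. t \<in> {0..1} \<Longrightarrow> \<bar>F t x y\<bar> \<le> M"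
  obtains x y where "x 1 = x 0" "y 1 = y 0"
    "\<And>t. t \<in> {0..1} \<Longrightarrow> (x has_real_derivative y t) (at t within {0..1})"
    "\<And>t. t \<in> {0..1} \<Longrightarrow> (y has_real_derivative x t - F t (x t) (y t)) (at t within {0..1})"
proof -
  define \<Phi> where "\<Phi> = (\<lambda>t z. F t ((fst z + snd z) / 2) ((fst z - snd z) / 2))"
  define g where "g = (\<lambda>t z. (fst z - \<Phi> t z, \<Phi> t z - snd z))"
  have cont\<Phi>: "continuous_on ({0..1} \<times> UNIV) (\<lambda>(t, z). \<Phi> t z)"
  proof -
    have "continuous_on ({0..1} \<times> UNIV)
        (\<lambda>p. (fst p, (fst (snd p) + snd (snd p)) / 2, (fst (snd p) - snd (snd p)) / 2) :: real \<times> real \<times> real)"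
      by (intro continuous_intros) auto
    then show ?thesis
      using continuous_on_compose2[OF cont] by (fastforce simp: \<Phi>_def split_def)
  qed
  have contg: "continuous_on ({0..1} \<times> UNIV) (\<lambda>(t, z). g t z)"
    unfolding g_def split_def
    by (intro continuous_intros cont\<Phi>[unfolded split_def])
  have grid: "real j * (1 / real N) \<in> {0..1}" if "j < N" for j N :: nat
    using that by (auto simp: field_simps)
  have "\<exists>z. euler g (1 / real N) N z = z \<and> (\<forall>k\<le>N. \<bar>fst (euler g (1 / real N) k z)\<bar> \<le> M
      \<and> \<bar>snd (euler g (1 / real N) k z)\<bar> \<le> M)" if N: "N > 0" for N
    unfolding g_def
  proof (rule euler_periodic_orbit[OF N])
    fix j assume j: "j < N"
    show "continuous_on UNIV (\<Phi> (real j * (1 / real N)))"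
      using continuous_on_compose2[OF cont\<Phi>, of UNIV "\<lambda>z. (real j * (1 / real N), z)"] grid[OF j]
      by (simp add: continuous_on_Pair image_subset_iff)
    show "\<bar>\<Phi> (real j * (1 / real N)) z\<bar> \<le> M" for z
      unfolding \<Phi>_def using grid[OF j] by (rule bd)
  qed
  then obtain z where z: "\<And>N. N > 0 \<Longrightarrow> euler g (1 / real N) N (z N) = z N"
    "\<And>N k. N > 0 \<Longrightarrow> k \<le> N \<Longrightarrow> \<bar>fst (euler g (1 / real N) k (z N))\<bar> \<le> M
      \<and> \<bar>snd (euler g (1 / real N) k (z N))\<bar> \<le> M"
    by metis
  have "\<exists>\<omega>. \<omega> 1 = \<omega> 0 \<and> (\<forall>t\<in>{0..1}. (\<omega> has_vector_derivative g t (\<omega> t)) (at t within {0..1}))"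
  proof (rule euler_limit[OF contg, where w = "\<lambda>N k. euler g (1 / real N) k (z N)"])
    fix N k :: nat assume "N > 0" "k \<le> N"
    then have "\<bar>fst (euler g (1 / real N) k (z N))\<bar> \<le> M" "\<bar>snd (euler g (1 / real N) k (z N))\<bar> \<le> M"
      using z by auto
    then show "norm (euler g (1 / real N) k (z N)) \<le> M + M"
      using norm_Pair_le[of "fst (euler g (1 / real N) k (z N))" "snd (euler g (1 / real N) k (z N))"]
      by simp
  qed (use z in auto)
  then obtain \<omega> where \<omega>: "\<omega> 1 = \<omega> 0"
    "\<And>t. t \<in> {0..1} \<Longrightarrow> (\<omega> has_vector_derivative g t (\<omega> t)) (at t within {0..1})"
    by auto
  have d: "((\<lambda>t. fst (\<omega> t)) has_real_derivative fst (\<omega> t) - \<Phi> t (\<omega> t)) (at t within {0..1})"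
    "((\<lambda>t. snd (\<omega> t)) has_real_derivative \<Phi> t (\<omega> t) - snd (\<omega> t)) (at t within {0..1})"
    if "t \<in> {0..1}" for t
    using bounded_linear.has_vector_derivative[OF bounded_linear_fst \<omega>(2)[OF that]]
      bounded_linear.has_vector_derivative[OF bounded_linear_snd \<omega>(2)[OF that]]
    by (auto simp: g_def has_real_derivative_iff_has_vector_derivative)
  show thesis
  proof
    fix t :: real assume t: "t \<in> {0..1}"
    show "((\<lambda>t. (fst (\<omega> t) + snd (\<omega> t)) / 2) has_real_derivative (fst (\<omega> t) - snd (\<omega> t)) / 2)
        (at t within {0..1})"
      using DERIV_cdivide[OF DERIV_add[OF d[OF t]], of 2] by simp
    show "((\<lambda>t. (fst (\<omega> t) - snd (\<omega> t)) / 2) has_real_derivative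
        (fst (\<omega> t) + snd (\<omega> t)) / 2 - F t ((fst (\<omega> t) + snd (\<omega> t)) / 2) ((fst (\<omega> t) - snd (\<omega> t)) / 2))
        (at t within {0..1})"
      using DERIV_cdivide[OF DERIV_diff[OF d[OF t]], of 2]
      by (simp add: \<Phi>_def field_simps)
  qed (simp_all add: \<omega>)
qed

section \<open>Nagumo estimates for the derivative\<close>

text \<open>\<open>r\<close> is the least point of the compact zero set; a nonpositive value before
  it would produce an earlier zero by the intermediate value theorem.\<close>

lemma first_zero:
  fixes v :: "real \<Rightarrow> real"
  assumes "continuous_on {s..z} v" "v s > 0" "s \<le> z" "v z = 0"
  obtains r where "s \<le> r" "r \<le> z" "v r = 0" "\<And>t. s \<le> t \<Longrightarrow> t < r \<Longrightarrow> v t > 0"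
proof -
  let ?Z = "{t \<in> {s..z}. v t = 0}"
  have "closed ?Z"
    using continuous_closed_preimage_constant[OF assms(1) closed_atLeastAtMost] by simp
  then have "compact ?Z"
    by (intro compact_eq_bounded_closed[THEN iffD2] conjI bounded_subset[OF bounded_closed_interval[of s z]]) auto
  moreover have "?Z \<noteq> {}" using assms by auto
  ultimately obtain r where r: "r \<in> ?Z" "\<And>t. t \<in> ?Z \<Longrightarrow> r \<le> t"
    using compact_attains_inf[of ?Z] by blast
  show thesis
  proof (rule that[of r])
    fix t assume t: "s \<le> t" "t < r"
    show "v t > 0"
    proof (rule ccontr)
      assume "\<not> v t > 0"
      moreover have "continuous_on {s..t} v"
        using t r(1) by (intro continuous_on_subset[OF assms(1)]) auto
      ultimately obtain t' where "s \<le> t'" "t' \<le> t" "v t' = 0"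
        using IVT2'[of v t 0 s] t assms(2) by auto
      with r(1) r(2)[of t'] t show False by auto
    qed
  qed (use r in auto)
qed

text \<open>One-sided Nagumo estimate: as long as \<open>v > 0\<close>, the quantity
  \<open>(C v\<^sup>2 + K) exp (2 C x)\<close> is nondecreasing. By periodicity \<open>v\<close> has a zero further on,
  possibly after passing once through the endpoint, and there the quantity is at most
  \<open>K exp (2 C b)\<close>.\<close>

lemma derivative_upper_bound:
  fixes x v w :: "real \<Rightarrow> real"
  assumes C: "C > 0" and K: "K > 0" and R: "R > 0" "K * exp (2 * C * (b - a)) \<le> C * R\<^sup>2"
    and dx: "\<And>t. t \<in> {0..1} \<Longrightarrow> (x has_real_derivative v t) (at t within {0..1})"
    and dv: "\<And>t. t \<in> {0..1} \<Longrightarrow> (v has_real_derivative w t) (at t within {0..1})"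
    and per: "x 0 = x 1" "v 0 = v 1"
    and range: "\<And>t. t \<in> {0..1} \<Longrightarrow> a \<le> x t \<and> x t \<le> b"
    and growth: "\<And>t. t \<in> {0..1} \<Longrightarrow> v t > 0 \<Longrightarrow> - (C * (v t)\<^sup>2 + K) \<le> w t"
    and t0: "t0 \<in> {0..1}"
  shows "v t0 < R"
proof (rule ccontr)
  assume "\<not> v t0 < R"
  then have vt0: "v t0 \<ge> R" "v t0 > 0" using R by auto
  define H where "H = (\<lambda>t. (C * (v t)\<^sup>2 + K) * exp (2 * C * x t))"
  \<comment> \<open>The derivative of \<open>H\<close>. Its middle factor is nonnegative by
    \<open>growth\<close> wherever v > 0.\<close>
  define H' where "H' = (\<lambda>t. 2 * C * v t * (w t + C * (v t)\<^sup>2 + K) * exp (2 * C * x t))"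
  have dH: "(H has_real_derivative H' t) (at t within {0..1})" if "t \<in> {0..1}" for t
    unfolding H_def H'_def
    by (rule derivative_eq_intros dx[OF that] dv[OF that] refl)+ (simp add: algebra_simps power2_eq_square)
  have contv: "continuous_on {0..1} v" and contx: "continuous_on {0..1} x"
    and contH: "continuous_on {0..1} H"
    by (rule DERIV_continuous_on[OF dv] DERIV_continuous_on[OF dx] DERIV_continuous_on[OF dH]; simp)+
  have inc: "H s \<le> H r" if "0 \<le> s" "s \<le> r" "r \<le> 1" "\<And>t. s < t \<Longrightarrow> t < r \<Longrightarrow> v t > 0" for s r
  proof (rule DERIV_nonneg_imp_increasing_open[OF \<open>s \<le> r\<close>])
    show "continuous_on {s..r} H" using that by (intro continuous_on_subset[OF contH]) auto
    fix t assume t: "s < t" "t < r"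
    then have "t \<in> {0..1}" "t \<in> interior {0..1}" using that by auto
    then have "(H has_real_derivative H' t) (at t)"
      using dH at_within_interior by metis
    moreover have "H' t \<ge> 0"
      using that(4)[OF t] growth[OF \<open>t \<in> {0..1}\<close>] C by (simp add: H'_def)
    ultimately show "\<exists>y. (H has_real_derivative y) (at t) \<and> 0 \<le> y" by blast
  qed
  have zero: "H s \<le> K * exp (2 * C * b)" if s: "0 \<le> s" "v s > 0" and z: "s \<le> z" "z \<le> 1" "v z = 0" for s z
  proof -
    obtain r where r: "s \<le> r" "r \<le> z" "v r = 0" "\<And>t. s \<le> t \<Longrightarrow> t < r \<Longrightarrow> v t > 0"
      using first_zero[of s z v] continuous_on_subset[OF contv, of "{s..z}"] s z by auto
    then have "H s \<le> H r" using s z by (intro inc) auto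
    also have "\<dots> \<le> K * exp (2 * C * b)"
      using r K C s z range[of r] by (simp add: H_def)
    finally show ?thesis .
  qed
  have "H t0 \<le> K * exp (2 * C * b)"
  proof (cases "\<exists>z\<in>{t0..1}. v z = 0")
    case True
    then show ?thesis using zero[of t0] vt0 t0 by auto
  next
    \<comment> \<open>Now v > 0 on [t0, 1], so \<open>H\<close> can be followed to 1 and continued
      from 0 by periodicity; Rolle's theorem for \<open>x\<close> supplies a zero of
      \<open>v\<close> in (0, 1) to stop at.\<close>
    case False
    have pos: "v t > 0" if t: "t \<in> {t0..1}" for t
    proof (rule ccontr)
      assume "\<not> v t > 0"
      moreover have "continuous_on {t0..t} v"
        using t t0 by (intro continuous_on_subset[OF contv]) auto
      ultimately obtain z where "t0 \<le> z" "z \<le> t" "v z = 0"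
        using IVT2'[of v t 0 t0] vt0 t by auto
      with False that show False by auto
    qed
    have "H t0 \<le> H 1" using t0 pos by (intro inc) auto
    also have "\<dots> = H 0" by (simp add: H_def per)
    also have "\<dots> \<le> K * exp (2 * C * b)"
    proof -
      have at: "(x has_real_derivative v t) (at t)" if "0 < t" "t < 1" for t
        using dx[of t] that at_within_interior[of t "{0..1}"] by auto
      obtain z where z: "0 < z" "z < 1" "(x has_real_derivative 0) (at z)"
        using Rolle[OF zero_less_one per(1) contx] at real_differentiable_def by blast
      then have "v z = 0" using DERIV_unique[OF at] by blast
      then show ?thesis using zero[of 0 z] z pos[of 1] per t0 by auto
    qed
    finally show ?thesis .
  qed
  \<comment> \<open>If v t0 \<ge> R and x t0 \<ge> a, then \<open>H t0\<close> is too large: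
    cancelling the exponential contradicts the choice of \<open>R\<close> because K > 0.\<close>
  moreover have "(C * R\<^sup>2 + K) * exp (2 * C * a) \<le> H t0"
    unfolding H_def using range[OF t0] vt0 R C K
    by (intro mult_mono add_mono power_mono) auto
  ultimately have "(C * R\<^sup>2 + K) * exp (2 * C * a) \<le> K * exp (2 * C * b)" by linarith
  also have "\<dots> = K * exp (2 * C * (b - a)) * exp (2 * C * a)"
    by (simp add: exp_add[symmetric] algebra_simps)
  finally have "C * R\<^sup>2 + K \<le> K * exp (2 * C * (b - a))" by simp
  then show False using R K by linarith
qed

text \<open>The lower bound is the upper bound for -x, whose range [-b, -a] has the same length, so
  the same \<open>R\<close> works.\<close>

lemma derivative_bound:
  fixes x v w :: "real \<Rightarrow> real"
  assumes CKR: "C > 0" "K > 0" "R > 0" "K * exp (2 * C * (b - a)) \<le> C * R\<^sup>2"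
    and dx: "\<And>t. t \<in> {0..1} \<Longrightarrow> (x has_real_derivative v t) (at t within {0..1})"
    and dv: "\<And>t. t \<in> {0..1} \<Longrightarrow> (v has_real_derivative w t) (at t within {0..1})"
    and per: "x 0 = x 1" "v 0 = v 1"
    and range: "\<And>t. t \<in> {0..1} \<Longrightarrow> a \<le> x t \<and> x t \<le> b"
    and growth: "\<And>t. t \<in> {0..1} \<Longrightarrow> v t > 0 \<Longrightarrow> - (C * (v t)\<^sup>2 + K) \<le> w t"
      "\<And>t. t \<in> {0..1} \<Longrightarrow> v t < 0 \<Longrightarrow> w t \<le> C * (v t)\<^sup>2 + K"
    and t0: "t0 \<in> {0..1}"
  shows "\<bar>v t0\<bar> < R"
proof -
  have "v t0 < R"
    by (rule derivative_upper_bound[OF CKR dx dv per range growth(1) t0])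
  moreover have "- v t0 < R"
  proof (rule derivative_upper_bound[where C = C and K = K and a = "- b" and b = "- a"
        and x = "\<lambda>t. - x t" and v = "\<lambda>t. - v t" and w = "\<lambda>t. - w t"])
    show "K * exp (2 * C * (- a - - b)) \<le> C * R\<^sup>2" using CKR(4) by simp
    show "- (C * (- v t)\<^sup>2 + K) \<le> - w t" if "t \<in> {0..1}" "0 < - v t" for t
      using growth(2)[of t] that by simp
  qed (use CKR dx dv per range t0 in \<open>auto intro!: derivative_intros\<close>)
  ultimately show ?thesis by linarith
qed

lemma has_derivative_reverse:
  fixes x :: "real \<Rightarrow> real"
  assumes "\<And>t. t \<in> {0..1} \<Longrightarrow> (x has_real_derivative v t) (at t within {0..1})" "t \<in> {0..1}"
  shows "((\<lambda>t. x (1 - t)) has_real_derivative - v (1 - t)) (at t within {0..1})"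
proof -
  have "(\<lambda>t. 1 - t) ` {0..1} = {0..1::real}" by (simp add: image_diff_atLeastAtMost)
  then have "(x has_real_derivative v (1 - t)) (at (1 - t) within (\<lambda>t. 1 - t) ` {0..1})"
    using assms by auto
  moreover have "((\<lambda>t. 1 - t) has_real_derivative - 1) (at t within {0..1})"
    by (auto intro!: derivative_eq_intros)
  ultimately show ?thesis using DERIV_image_chain by (fastforce simp: o_def)
qed

text \<open>Passing to x(1 - t) flips the sign of the first derivative and keeps that of the second,
  which turns these growth conditions into those of \<open>derivative_bound\<close>.\<close>

lemma derivative_bound_reversed:
  fixes x v w :: "real \<Rightarrow> real"
  assumes CKR: "C > 0" "K > 0" "R > 0" "K * exp (2 * C * (b - a)) \<le> C * R\<^sup>2"
    and dx: "\<And>t. t \<in> {0..1} \<Longrightarrow> (x has_real_derivative v t) (at t within {0..1})"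
    and dv: "\<And>t. t \<in> {0..1} \<Longrightarrow> (v has_real_derivative w t) (at t within {0..1})"
    and per: "x 0 = x 1" "v 0 = v 1"
    and range: "\<And>t. t \<in> {0..1} \<Longrightarrow> a \<le> x t \<and> x t \<le> b"
    and growth: "\<And>t. t \<in> {0..1} \<Longrightarrow> v t > 0 \<Longrightarrow> w t \<le> C * (v t)\<^sup>2 + K"
      "\<And>t. t \<in> {0..1} \<Longrightarrow> v t < 0 \<Longrightarrow> - (C * (v t)\<^sup>2 + K) \<le> w t"
    and t0: "t0 \<in> {0..1}"
  shows "\<bar>v t0\<bar> < R"
proof -
  have "\<bar>- v (1 - (1 - t0))\<bar> < R"
  proof (rule derivative_bound[OF CKR, where x = "\<lambda>t. x (1 - t)" and v = "\<lambda>t. - v (1 - t)"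
        and w = "\<lambda>t. w (1 - t)"])
    fix t :: real assume t: "t \<in> {0..1}"
    show "((\<lambda>t. x (1 - t)) has_real_derivative - v (1 - t)) (at t within {0..1})"
      by (rule has_derivative_reverse[OF dx t])
    show "((\<lambda>t. - v (1 - t)) has_real_derivative w (1 - t)) (at t within {0..1})"
      using DERIV_minus[OF has_derivative_reverse[OF dv t]] by simp
    show "a \<le> x (1 - t) \<and> x (1 - t) \<le> b" using range t by auto
    show "- (C * (- v (1 - t))\<^sup>2 + K) \<le> w (1 - t)" if "0 < - v (1 - t)"
      using growth(2)[of "1 - t"] t that by auto
    show "w (1 - t) \<le> C * (- v (1 - t))\<^sup>2 + K" if "- v (1 - t) < 0"
      using growth(1)[of "1 - t"] t that by auto
  qed (use per t0 in auto)
  then show ?thesis by simp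
qed

section \<open>A minimum principle for periodic boundary conditions\<close>

text \<open>At a negative minimum z' vanishes, so \<open>neg\<close> makes \<open>z\<close> decrease
  strictly just to the right of it. Asking for \<open>neg\<close> only where z' = 0 matters: in the
  application the derivative of the solution then equals that of \<alpha> or \<beta>.\<close>

lemma nonneg_by_minimum_principle:
  fixes z z' z'' :: "real \<Rightarrow> real"
  assumes dz: "\<And>t. t \<in> {0..1} \<Longrightarrow> (z has_real_derivative z' t) (at t within {0..1})"
    and dz': "\<And>t. t \<in> {0..1} \<Longrightarrow> (z' has_real_derivative z'' t) (at t within {0..1})"
    and bc: "z 0 = z 1" "z' 0 \<le> z' 1"
    and neg: "\<And>t. t \<in> {0..1} \<Longrightarrow> z t < 0 \<Longrightarrow> z' t = 0 \<Longrightarrow> z'' t < 0"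
    and t: "t \<in> {0..1}"
  shows "z t \<ge> 0"
proof (rule ccontr)
  assume "\<not> z t \<ge> 0"
  have contz: "continuous_on {0..1} z"
    by (rule DERIV_continuous_on[OF dz])
  then obtain m where m: "m \<in> {0..1}" "\<And>s. s \<in> {0..1} \<Longrightarrow> z m \<le> z s"
    using continuous_attains_inf[of "{0..1}" z] t by auto
  \<comment> \<open>A minimum at 1 is moved to 0, using z 0 = z 1, so that there is room to its
    right.\<close>
  define t1 where "t1 = (if m = 1 then 0 else m)"
  have t1: "0 \<le> t1" "t1 < 1" "\<And>s. s \<in> {0..1} \<Longrightarrow> z t1 \<le> z s"
    using m bc by (auto simp: t1_def)
  have at: "(z has_real_derivative z' s) (at s)" if "0 < s" "s < 1" for s
    using dz[of s] that at_within_interior[of s "{0..1}"] by auto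
  have "z' t1 = 0"
  proof (cases "t1 = 0")
    \<comment> \<open>Both endpoints are minima here, hence z' 0 \<ge> 0 \<ge> z' 1; the boundary
      inequality z' 0 \<le> z' 1 forces both to vanish.\<close>
    case True
    have "z' 0 \<ge> 0"
    proof (rule ccontr)
      assume "\<not> z' 0 \<ge> 0"
      then obtain d where d: "d > 0" "\<And>h. h > 0 \<Longrightarrow> 0 + h \<in> {0..1} \<Longrightarrow> h < d \<Longrightarrow> z 0 > z (0 + h)"
        using has_real_derivative_neg_dec_right[OF dz[of 0]] by auto
      obtain h where "0 < h" "h < d" "h \<le> 1"
        using d(1) that[of "min (d / 2) 1"] by (auto simp: min_def split: if_splits)
      then show False using d(2)[of h] t1(3)[of h] True by simp
    qed
    moreover have "z' 1 \<le> 0"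
    proof (rule ccontr)
      assume "\<not> z' 1 \<le> 0"
      then obtain d where d: "d > 0" "\<And>h. h > 0 \<Longrightarrow> 1 - h \<in> {0..1} \<Longrightarrow> h < d \<Longrightarrow> z (1 - h) < z 1"
        using has_real_derivative_pos_inc_left[OF dz[of 1]] by auto
      obtain h where "0 < h" "h < d" "h \<le> 1"
        using d(1) that[of "min (d / 2) 1"] by (auto simp: min_def split: if_splits)
      then show False using d(2)[of h] t1(3)[of "1 - h"] True bc by simp
    qed
    ultimately show ?thesis using bc True by simp
  next
    case False
    then have "0 < t1" using t1 by simp
    have "min t1 (1 - t1) > 0" using \<open>0 < t1\<close> t1 by simp
    moreover have "z t1 \<le> z s" if "\<bar>t1 - s\<bar> < min t1 (1 - t1)" for s
      using that by (intro t1(3)) auto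
    ultimately show ?thesis
      using DERIV_local_min[OF at[OF \<open>0 < t1\<close> t1(2)]] by blast
  qed
  moreover have "z t1 < 0" using \<open>\<not> z t \<ge> 0\<close> t1(3)[OF t] by linarith
  ultimately have "z'' t1 < 0" using neg t1 by auto
  then obtain d where d: "d > 0" "\<And>h. h > 0 \<Longrightarrow> t1 + h \<in> {0..1} \<Longrightarrow> h < d \<Longrightarrow> z' (t1 + h) < z' t1"
    using has_real_derivative_neg_dec_right[OF dz'[of t1]] t1 by auto
  define h where "h = min (d / 2) ((1 - t1) / 2)"
  have h: "h > 0" "h < d" "t1 + h < 1" using d t1 by (auto simp: h_def min_def field_simps)
  have "z (t1 + h) < z t1"
  proof (rule DERIV_neg_imp_decreasing_open[of t1 "t1 + h" z])
    show "continuous_on {t1..t1 + h} z"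
      using t1 h by (intro continuous_on_subset[OF contz]) auto
    fix s assume s: "t1 < s" "s < t1 + h"
    then have "z' s < 0" using d(2)[of "s - t1"] h t1 \<open>z' t1 = 0\<close> by auto
    moreover have "(z has_real_derivative z' s) (at s)" using s t1 h by (intro at) auto
    ultimately show "\<exists>y. (z has_real_derivative y) (at s) \<and> y < 0" by blast
  qed (use h in auto)
  moreover have "t1 + h \<in> {0..1}" using t1(1) h by simp
  ultimately show False using t1(3)[of "t1 + h"] by linarith
qed

section \<open>One-sided quadratic growth of the nonlinearity\<close>

lemma bounded_on_box:
  fixes f :: "real \<Rightarrow> real \<Rightarrow> real \<Rightarrow> real"
  assumes "continuous_on ({0..1} \<times> UNIV) (\<lambda>(t, x, y). f t x y)"
  obtains M where "M \<ge> 0" "\<And>t x y. t \<in> {0..1} \<Longrightarrow> a \<le> x \<Longrightarrow> x \<le> b \<Longrightarrow> \<bar>y\<bar> \<le> r \<Longrightarrow> \<bar>f t x y\<bar> \<le> M"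
proof -
  have "compact ((\<lambda>(t, x, y). f t x y) ` ({0..1} \<times> {a..b} \<times> {-r..r}))"
    by (intro compact_continuous_image continuous_on_subset[OF assms] compact_Times) auto
  from bounded_pos[THEN iffD1, OF compact_imp_bounded[OF this]]
  obtain M where M: "M > 0"
    "\<forall>z\<in>(\<lambda>(t, x, y). f t x y) ` ({0..1} \<times> {a..b} \<times> {-r..r}). norm z \<le> M"
    by (elim exE conjE) (rule that)
  show thesis
  proof (rule that[of M])
    fix t x y :: real assume "t \<in> {0..1}" "a \<le> x" "x \<le> b" "\<bar>y\<bar> \<le> r"
    then have "(t, x, y) \<in> {0..1} \<times> {a..b} \<times> {-r..r}" by (simp add: abs_le_iff)
    from bspec[OF M(2) imageI[OF this]] show "\<bar>f t x y\<bar> \<le> M" by simp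
  qed (use M in simp)
qed

text \<open>The summand \<open>f2\<close> need not be bounded a priori, but by monotonicity it is controlled for
  \<open>y > - y1\<close> by its value \<open>f - f1\<close> at \<open>- y1\<close>, where the condition on \<open>f1\<close> applies.\<close>

lemma one_sided_quadratic_growth:
  fixes f f1 f2 :: "real \<Rightarrow> real \<Rightarrow> real \<Rightarrow> real" and \<alpha> \<beta> c :: "real \<Rightarrow> real"
  assumes cont: "continuous_on ({0..1} \<times> UNIV) (\<lambda>(t, x, y). f t x y)"
    and sum: "\<And>t x y. t \<in> {0..1} \<Longrightarrow> f t x y = f1 t x y + f2 t x y"
    and range: "\<And>t. t \<in> {0..1} \<Longrightarrow> a \<le> \<alpha> t" "\<And>t. t \<in> {0..1} \<Longrightarrow> \<beta> t \<le> b"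
    and contc: "continuous_on {0..1} c"
    and f1: "unif_limsup_le (Gamma_set \<alpha> \<beta>) (\<lambda>t x y. y * f1 t x y / \<bar>y\<bar> ^ 3) c"
    and f2: "\<forall>(t, x)\<in>Gamma_set \<alpha> \<beta>. antimono (\<lambda>y. f2 t x y)"
  obtains C K where "C > 0" "K > 0"
    "\<And>t x y. (t, x) \<in> Gamma_set \<alpha> \<beta> \<Longrightarrow> y > 0 \<Longrightarrow> f t x y \<le> C * y\<^sup>2 + K"
    "\<And>t x y. (t, x) \<in> Gamma_set \<alpha> \<beta> \<Longrightarrow> y < 0 \<Longrightarrow> - (C * y\<^sup>2 + K) \<le> f t x y"
proof -
  have "bounded (c ` {0..1})" by (intro compact_imp_bounded compact_continuous_image contc compact_Icc)
  then obtain c1 where c1: "c1 > 0" "\<And>t. t \<in> {0..1} \<Longrightarrow> \<bar>c t\<bar> \<le> c1"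
    unfolding bounded_pos by auto
  \<comment> \<open>The bound of |c| plus the value 1 taken for \<epsilon>.\<close>
  define C where "C = c1 + 1"
  obtain y0 where y0: "y0 > 0"
    "\<forall>(t, x)\<in>Gamma_set \<alpha> \<beta>. \<forall>y. \<bar>y\<bar> > y0 \<longrightarrow> y * f1 t x y / \<bar>y\<bar> ^ 3 \<le> c t + 1"
    using f1 zero_less_one unfolding unif_limsup_le_def by blast
  define y1 where "y1 = y0 + 1"
  have quot: "y * f1 t x y / \<bar>y\<bar> ^ 3 \<le> C" if "(t, x) \<in> Gamma_set \<alpha> \<beta>" "\<bar>y\<bar> > y0" for t x y
  proof -
    have "t \<in> {0..1}" using that by (auto simp: Gamma_set_def)
    then show ?thesis using bspec[OF y0(2) that(1)] that(2) c1(2)[of t] by (force simp: C_def)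
  qed
  \<comment> \<open>The quotient is f1/y^2 for y > 0 and -f1/y^2 for y < 0, so one condition bounds
    \<open>f1\<close> from above on the right and, in \<open>neg\<close>, from below on the
    left.\<close>
  have pos: "f1 t x y \<le> C * y\<^sup>2" if "(t, x) \<in> Gamma_set \<alpha> \<beta>" "y > y0" for t x y
  proof -
    have "f1 t x y / y\<^sup>2 = y * f1 t x y / \<bar>y\<bar> ^ 3"
      using that y0(1) by (simp add: power2_eq_square power3_eq_cube)
    then have "f1 t x y / y\<^sup>2 \<le> C" using quot[of t x y] that by simp
    moreover have "y\<^sup>2 > 0" using that y0(1) by simp
    ultimately show ?thesis by (simp only: pos_divide_le_eq)
  qed
  have neg: "- (C * y\<^sup>2) \<le> f1 t x y" if "(t, x) \<in> Gamma_set \<alpha> \<beta>" "y < - y0" for t x y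
  proof -
    have "- (f1 t x y) / (- y) ^ 2 = y * f1 t x y / \<bar>y\<bar> ^ 3"
      using that y0(1) by (simp add: power2_eq_square power3_eq_cube)
    then have "- (f1 t x y) / (- y) ^ 2 \<le> C" using quot[of t x y] that by simp
    moreover have "(- y) ^ 2 > 0" using that y0(1) by simp
    ultimately have "- (f1 t x y) \<le> C * (- y) ^ 2" by (simp only: pos_divide_le_eq)
    then show ?thesis by simp
  qed
  obtain M where M: "M \<ge> 0" "\<And>t x y. t \<in> {0..1} \<Longrightarrow> a \<le> x \<Longrightarrow> x \<le> b \<Longrightarrow> \<bar>y\<bar> \<le> y1 \<Longrightarrow> \<bar>f t x y\<bar> \<le> M"
    using bounded_on_box[OF cont] by metis
  \<comment> \<open>M + C y1^2 bounds f2 = f - f1 from above at -y1 and its negative from above at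
    y1; the 1 ensures positivity.\<close>
  define K where "K = M + C * y1\<^sup>2 + 1"
  have C0: "C > 0" using c1 by (simp add: C_def)
  have Kp: "K > 0" "M \<le> K" "M + C * y1\<^sup>2 \<le> K" using M C0 by (auto simp: K_def add_nonneg_pos)
  have fM: "\<bar>f t x y\<bar> \<le> M" if "(t, x) \<in> Gamma_set \<alpha> \<beta>" "\<bar>y\<bar> \<le> y1" for t x y
    using that range[of t] by (intro M) (auto simp: Gamma_set_def)
  have split: "f t x y = f1 t x y + f2 t x y" if "(t, x) \<in> Gamma_set \<alpha> \<beta>" for t x y
    using sum that by (auto simp: Gamma_set_def)
  have y1: "y1 > 0" "y1 > y0" using y0 by (auto simp: y1_def)
  show thesis
  proof (rule that[OF C0 Kp(1)])
    fix t x y assume G: "(t, x) \<in> Gamma_set \<alpha> \<beta>"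
    have anti: "antimono (\<lambda>y. f2 t x y)" using f2 G by auto
    have Cy: "C * y\<^sup>2 \<ge> 0" using C0 by simp
    show "f t x y \<le> C * y\<^sup>2 + K" if "y > 0"
    proof (cases "y \<le> y1")
      case True
      then show ?thesis using fM[OF G, of y] that Kp Cy by auto
    next
      case False
      \<comment> \<open>The comparison point is -y1 and not y1: bounding f2 = f - f1 from above
        takes a lower bound of \<open>f1\<close>, which is available at negative arguments.\<close>
      have "f2 t x y \<le> f2 t x (- y1)" using antimonoD[OF anti, of "- y1" y] that y1 by simp
      moreover have "f t x (- y1) \<le> M" "- (C * y1\<^sup>2) \<le> f1 t x (- y1)"
        using fM[OF G, of "- y1"] neg[OF G, of "- y1"] y1 by auto
      ultimately show ?thesis
        using pos[OF G, of y] split[OF G, of y] split[OF G, of "- y1"] False y1 Kp by linarith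
    qed
    show "- (C * y\<^sup>2 + K) \<le> f t x y" if "y < 0"
    proof (cases "- y1 \<le> y")
      case True
      then show ?thesis using fM[OF G, of y] that Kp Cy by auto
    next
      case False
      have "f2 t x y1 \<le> f2 t x y" using antimonoD[OF anti, of y y1] that y1 by simp
      moreover have "- M \<le> f t x y1" "f1 t x y1 \<le> C * y1\<^sup>2"
        using fM[OF G, of y1] pos[OF G, of y1] y1 by auto
      ultimately show ?thesis
        using neg[OF G, of y] split[OF G, of y] split[OF G, of y1] False y1 Kp by linarith
    qed
  qed
qed

section \<open>One-sided derivatives on [0, 1] and classical solutions\<close>

lemma deriv01_eq:
  assumes "(u has_real_derivative d) (at t within {0..1})" "t \<in> {0..1}"
  shows "deriv01 u t = d"
  unfolding deriv01_def using assms
  by (intro vector_derivative_within_closed_interval)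
    (auto simp: has_real_derivative_iff_has_vector_derivative)

lemma C1_01_has_derivative:
  assumes "C1_01 u" "t \<in> {0..1}"
  shows "(u has_real_derivative deriv01 u t) (at t within {0..1})"
  using assms unfolding C1_01_def deriv01_def has_real_derivative_iff_has_vector_derivative
  by (simp add: vector_derivative_works[symmetric])

lemma C1_01I:
  assumes "\<And>t. t \<in> {0..1} \<Longrightarrow> (u has_real_derivative u' t) (at t within {0..1})"
    and "continuous_on {0..1} u'"
  shows "C1_01 u"
  unfolding C1_01_def
proof
  show "\<forall>t\<in>{0..1}. u differentiable (at t within {0..1})"
    using assms(1) unfolding real_differentiable_def by blast
  show "continuous_on {0..1} (deriv01 u)"
    using assms(2) by (rule continuous_on_eq) (simp add: deriv01_eq[OF assms(1)])
qed

text \<open>C^2 regularity comes from the equation itself, since -f(t, x, v) is continuous along the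
  solution. As \<open>deriv01 x\<close> is known to agree with \<open>v\<close> only on [0, 1], the
  derivative of \<open>v\<close> has to be transferred to it within that interval.\<close>

lemma periodic_solutionI:
  assumes dx: "\<And>t. t \<in> {0..1} \<Longrightarrow> (x has_real_derivative v t) (at t within {0..1})"
    and dv: "\<And>t. t \<in> {0..1} \<Longrightarrow> (v has_real_derivative - f t (x t) (v t)) (at t within {0..1})"
    and cont: "continuous_on ({0..1} \<times> UNIV) (\<lambda>(t, x, y). f t x y)"
    and per: "x 0 = x 1" "v 0 = v 1"
  shows "periodic_solution f x"
proof -
  have contx: "continuous_on {0..1} x" by (rule DERIV_continuous_on[OF dx])
  have contv: "continuous_on {0..1} v" by (rule DERIV_continuous_on[OF dv])
  have "continuous_on {0..1} (\<lambda>t. (t, x t, v t))"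
    by (intro continuous_intros contx contv)
  then have contf: "continuous_on {0..1} (\<lambda>t. - f t (x t) (v t))"
    using continuous_on_compose2[OF cont, of "{0..1}" "\<lambda>t. (t, x t, v t)"]
    by (auto intro!: continuous_on_minus)
  have eq: "deriv01 x t = v t" if "t \<in> {0..1}" for t
    by (rule deriv01_eq[OF dx[OF that] that])
  have dv': "(deriv01 x has_real_derivative - f t (x t) (v t)) (at t within {0..1})"
    if "t \<in> {0..1}" for t
    by (rule has_field_derivative_transform_within[OF dv[OF that] zero_less_one that]) (simp add: eq)
  have "C2_01 x"
    unfolding C2_01_def using C1_01I[OF dx contv] C1_01I[OF dv' contf] by simp
  moreover have "deriv01 (deriv01 x) t = - f t (x t) (v t)" if "t \<in> {0..1}" for t
    by (rule deriv01_eq[OF dv'[OF that] that])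
  ultimately show ?thesis
    by (simp add: periodic_solution_def eq per)
qed

section \<open>The truncated problem between lower and upper solution\<close>

text \<open>Where x < \<alpha> and x' = \<alpha>', the truncations return \<alpha> and, because
  \<open>R\<close> dominates |\<alpha>'|, also \<alpha>'. The lower solution inequality then gives
  (x - \<alpha>)'' \<le> x - \<alpha> < 0, as the minimum principle requires; \<beta> is symmetric.
  The cutoff of x' remains in the conclusion.\<close>

lemma truncated_bvp:
  fixes f :: "real \<Rightarrow> real \<Rightarrow> real \<Rightarrow> real"
  assumes cont: "continuous_on ({0..1} \<times> UNIV) (\<lambda>(t, x, y). f t x y)"
    and lower: "lower_solution f \<alpha>" and upper: "upper_solution f \<beta>"
    and le: "\<And>t. t \<in> {0..1} \<Longrightarrow> \<alpha> t \<le> \<beta> t"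
    and bcs: "deriv01 \<alpha> 1 \<le> deriv01 \<alpha> 0" "deriv01 \<beta> 0 \<le> deriv01 \<beta> 1"
    and R: "\<And>t. t \<in> {0..1} \<Longrightarrow> \<bar>deriv01 \<alpha> t\<bar> \<le> R" "\<And>t. t \<in> {0..1} \<Longrightarrow> \<bar>deriv01 \<beta> t\<bar> \<le> R"
  obtains x v where "x 0 = x 1" "v 0 = v 1"
    "\<And>t. t \<in> {0..1} \<Longrightarrow> \<alpha> t \<le> x t \<and> x t \<le> \<beta> t"
    "\<And>t. t \<in> {0..1} \<Longrightarrow> (x has_real_derivative v t) (at t within {0..1})"
    "\<And>t. t \<in> {0..1} \<Longrightarrow>
      (v has_real_derivative - f t (x t) (max (- R) (min R (v t)))) (at t within {0..1})"
proof -
  have C1: "C1_01 \<alpha>" "C1_01 (deriv01 \<alpha>)" "C1_01 \<beta>" "C1_01 (deriv01 \<beta>)"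
    and ends: "\<alpha> 0 = \<alpha> 1" "\<beta> 0 = \<beta> 1"
    and ineq: "\<And>t. t \<in> {0..1} \<Longrightarrow> - deriv01 (deriv01 \<alpha>) t \<le> f t (\<alpha> t) (deriv01 \<alpha> t)"
      "\<And>t. t \<in> {0..1} \<Longrightarrow> f t (\<beta> t) (deriv01 \<beta> t) \<le> - deriv01 (deriv01 \<beta>) t"
    using lower upper by (auto simp: lower_solution_def upper_solution_def C2_01_def)
  note d = C1[THEN C1_01_has_derivative]
  have cont\<alpha>: "continuous_on {0..1} \<alpha>" and cont\<beta>: "continuous_on {0..1} \<beta>"
    by (rule DERIV_continuous_on[OF d(1)] DERIV_continuous_on[OF d(3)]; simp)+
  have R0: "R \<ge> 0" using R(1)[of 0] by simp
  define p where "p = (\<lambda>t x. max (\<alpha> t) (min (\<beta> t) x))"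
  define q where "q = (\<lambda>y. max (- R) (min R y))"
  \<comment> \<open>Adding \<open>p t x\<close> cancels the linear term x inside the strip, where
    x'' = x - F becomes x'' = -f.\<close>
  define F where "F = (\<lambda>t x y. f t (p t x) (q y) + p t x)"
  have p: "\<alpha> t \<le> p t x \<and> p t x \<le> \<beta> t" if "t \<in> {0..1}" for t x
    using le[OF that] by (auto simp: p_def)
  have q: "\<bar>q y\<bar> \<le> R" for y using R0 by (auto simp: q_def)
  have "bounded (\<alpha> ` {0..1})" "bounded (\<beta> ` {0..1})"
    by (intro compact_imp_bounded compact_continuous_image cont\<alpha> cont\<beta> compact_Icc)+
  then obtain A B where "\<forall>t\<in>{0..1}. \<bar>\<alpha> t\<bar> \<le> A" "\<forall>t\<in>{0..1}. \<bar>\<beta> t\<bar> \<le> B"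
    unfolding bounded_iff by auto
  then have AB: "\<And>t. t \<in> {0..1} \<Longrightarrow> \<bar>\<alpha> t\<bar> \<le> A" "\<And>t. t \<in> {0..1} \<Longrightarrow> \<bar>\<beta> t\<bar> \<le> B"
    by blast+
  have pAB: "- A \<le> p t x \<and> p t x \<le> B" if "t \<in> {0..1}" for t x
    using p[OF that, of x] AB[OF that] by (auto simp: abs_le_iff)
  obtain M where M: "\<And>t x y. t \<in> {0..1} \<Longrightarrow> - A \<le> x \<Longrightarrow> x \<le> B \<Longrightarrow> \<bar>y\<bar> \<le> R \<Longrightarrow> \<bar>f t x y\<bar> \<le> M"
    by (rule bounded_on_box[OF cont, of "- A" B R], rule that)
  have contF: "continuous_on ({0..1} \<times> UNIV) (\<lambda>(t, x, y). F t x y)"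
  proof -
    let ?S = "{0..1::real} \<times> (UNIV :: (real \<times> real) set)"
    have "continuous_on ?S (\<lambda>z. \<alpha> (fst z))" "continuous_on ?S (\<lambda>z. \<beta> (fst z))"
      by (rule continuous_on_compose2[OF cont\<alpha>] continuous_on_compose2[OF cont\<beta>];
          auto intro!: continuous_intros)+
    then have c: "continuous_on ?S (\<lambda>z. p (fst z) (fst (snd z)))"
      unfolding p_def by (intro continuous_intros)
    moreover have "continuous_on ?S (\<lambda>z. q (snd (snd z)))"
      unfolding q_def by (intro continuous_intros)
    ultimately have "continuous_on ?S (\<lambda>z. (fst z, p (fst z) (fst (snd z)), q (snd (snd z))))"
      by (intro continuous_intros)
    then have "continuous_on ?S (\<lambda>z. f (fst z) (p (fst z) (fst (snd z))) (q (snd (snd z))))"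
      using continuous_on_compose2[OF cont, of ?S "\<lambda>z. (fst z, p (fst z) (fst (snd z)), q (snd (snd z)))"]
      by (simp add: split_def mem_Times_iff image_subset_iff)
    then show ?thesis
      unfolding F_def split_def by (intro continuous_on_add c)
  qed
  have bdF: "\<bar>F t x y\<bar> \<le> M + (A + B)" if "t \<in> {0..1}" for t x y
  proof -
    have "\<bar>f t (p t x) (q y)\<bar> \<le> M" using pAB[OF that, of x] by (intro M that q) auto
    moreover have "\<bar>p t x\<bar> \<le> A + B" using pAB[OF that, of x] AB[OF that] by linarith
    ultimately show ?thesis unfolding F_def by linarith
  qed
  obtain x v where xv: "x 1 = x 0" "v 1 = v 0"
    and dx: "\<And>t. t \<in> {0..1} \<Longrightarrow> (x has_real_derivative v t) (at t within {0..1})"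
    and dv: "\<And>t. t \<in> {0..1} \<Longrightarrow> (v has_real_derivative x t - F t (x t) (v t)) (at t within {0..1})"
    by (rule bounded_periodic_bvp[OF contF bdF], assumption, rule that)
  have lo: "x t - \<alpha> t \<ge> 0" if t: "t \<in> {0..1}" for t
  proof (rule nonneg_by_minimum_principle[where z = "\<lambda>t. x t - \<alpha> t", OF DERIV_diff[OF dx d(1)]
        DERIV_diff[OF dv d(2)] _ _ _ t])
    fix s assume s: "s \<in> {0..1}" "x s - \<alpha> s < 0" "v s - deriv01 \<alpha> s = 0"
    then have "p s (x s) = \<alpha> s" "q (v s) = deriv01 \<alpha> s"
      using le[of s] R(1)[of s] by (auto simp: p_def q_def max_def min_def)
    then show "x s - F s (x s) (v s) - deriv01 (deriv01 \<alpha>) s < 0"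
      using ineq(1)[of s] s by (simp add: F_def)
  qed (use xv ends bcs in auto)
  have up: "\<beta> t - x t \<ge> 0" if t: "t \<in> {0..1}" for t
  proof (rule nonneg_by_minimum_principle[where z = "\<lambda>t. \<beta> t - x t", OF DERIV_diff[OF d(3) dx]
        DERIV_diff[OF d(4) dv] _ _ _ t])
    fix s assume s: "s \<in> {0..1}" "\<beta> s - x s < 0" "deriv01 \<beta> s - v s = 0"
    then have "p s (x s) = \<beta> s" "q (v s) = deriv01 \<beta> s"
      using le[of s] R(2)[of s] by (auto simp: p_def q_def max_def min_def)
    then show "deriv01 (deriv01 \<beta>) s - (x s - F s (x s) (v s)) < 0"
      using ineq(2)[of s] s by (simp add: F_def)
  qed (use xv ends bcs in auto)
  show thesis
  proof (rule that[of x v])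
    fix t :: real assume t: "t \<in> {0..1}"
    show "\<alpha> t \<le> x t \<and> x t \<le> \<beta> t" using lo up t by simp
    then have "p t (x t) = x t" by (simp add: p_def)
    then show "(v has_real_derivative - f t (x t) (max (- R) (min R (v t)))) (at t within {0..1})"
      using dv[OF t] by (simp add: F_def q_def)
  qed (use xv dx in auto)
qed

section \<open>Choice of the cutoff level and removal of the cutoff\<close>

theorem theorem3p6:
  fixes f f1 f2 :: "real \<Rightarrow> real \<Rightarrow> real \<Rightarrow> real"
    and \<alpha> \<beta> c :: "real \<Rightarrow> real"
    and \<mu> l c0 :: real
  assumes "continuous_on ({0..1} \<times> UNIV) (\<lambda>(t, x, y). f t x y)"
    and "\<And>t x y. t \<in> {0..1} \<Longrightarrow> f t x y = f1 t x y + f2 t x y"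
    and "lower_solution f \<alpha>"
    and "upper_solution f \<beta>"
    and "\<And>t. t \<in> {0..1} \<Longrightarrow> \<alpha> t \<le> \<beta> t"
    and "deriv01 \<alpha> 0 - deriv01 \<alpha> 1 \<ge> 0"
    and "deriv01 \<beta> 1 - deriv01 \<beta> 0 \<ge> 0"
    and "\<mu> > 0" and "l > 0"
    and "\<And>t x1 y1 x2 y2.
           ((t, x1, y1) \<in> G_set \<alpha> \<mu> \<and> (t, x2, y2) \<in> G_set \<alpha> \<mu>) \<or>
           ((t, x1, y1) \<in> G_set \<beta> \<mu> \<and> (t, x2, y2) \<in> G_set \<beta> \<mu>) \<Longrightarrow>
           \<bar>f t x1 y1 - f t x2 y2\<bar> \<le> l * \<bar>x1 - x2\<bar> + l * \<bar>y1 - y2\<bar>"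
    and "continuous_on {0..1} c"
    and "c0 < 1"
    and "\<And>t. t \<in> {0..1} \<Longrightarrow> c t * (\<beta> t - \<alpha> t) \<le> c0"
    and "(unif_limsup_le (Gamma_set \<alpha> \<beta>) (\<lambda>t x y. y * f1 t x y / \<bar>y\<bar> ^ 3) c \<and>
            (\<forall>(t, x)\<in>Gamma_set \<alpha> \<beta>. antimono (\<lambda>y. f2 t x y))) \<or>
         (unif_liminf_ge (Gamma_set \<alpha> \<beta>) (\<lambda>t x y. y * f1 t x y / \<bar>y\<bar> ^ 3) (\<lambda>t. - c t) \<and>
            (\<forall>(t, x)\<in>Gamma_set \<alpha> \<beta>. mono (\<lambda>y. f2 t x y)))"
  shows "\<exists>x. periodic_solution f x \<and> (\<forall>t\<in>{0..1}. \<alpha> t \<le> x t \<and> x t \<le> \<beta> t)"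
proof -
  note cont = assms(1)
  have C1: "C1_01 \<alpha>" "C1_01 \<beta>"
    using assms(3,4) by (auto simp: lower_solution_def upper_solution_def C2_01_def)
  have bd: "\<exists>B. \<forall>t\<in>{0..1}. \<bar>u t\<bar> \<le> B" if "continuous_on {0..1} u" for u :: "real \<Rightarrow> real"
    using compact_imp_bounded[OF compact_continuous_image[OF that compact_Icc]]
    by (auto simp: bounded_iff)
  have cont01: "continuous_on {0..1} \<alpha>" "continuous_on {0..1} \<beta>"
    by (rule C1[THEN C1_01_has_derivative, THEN DERIV_continuous_on]; simp)+
  have contd: "continuous_on {0..1} (deriv01 \<alpha>)" "continuous_on {0..1} (deriv01 \<beta>)"
    using C1 by (simp_all add: C1_01_def)
  from cont01[THEN bd] contd[THEN bd] obtain A B A' B' where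
    AB: "\<forall>t\<in>{0..1}. \<bar>\<alpha> t\<bar> \<le> A" "\<forall>t\<in>{0..1}. \<bar>\<beta> t\<bar> \<le> B"
    and AB': "\<forall>t\<in>{0..1}. \<bar>deriv01 \<alpha> t\<bar> \<le> A'" "\<forall>t\<in>{0..1}. \<bar>deriv01 \<beta> t\<bar> \<le> B'"
    by (elim exE) (rule that)
  have range: "- A \<le> \<alpha> t" "\<beta> t \<le> B" if "t \<in> {0..1}" for t
    using AB[THEN bspec, OF that] by (auto simp: abs_le_iff)
  obtain C K where CK: "C > 0" "K > 0"
    and growth: "(\<forall>(t, x)\<in>Gamma_set \<alpha> \<beta>. \<forall>y. (y > 0 \<longrightarrow> f t x y \<le> C * y\<^sup>2 + K)
                    \<and> (y < 0 \<longrightarrow> - (C * y\<^sup>2 + K) \<le> f t x y)) \<or>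
                 (\<forall>(t, x)\<in>Gamma_set \<alpha> \<beta>. \<forall>y. (y > 0 \<longrightarrow> - (C * y\<^sup>2 + K) \<le> f t x y)
                    \<and> (y < 0 \<longrightarrow> f t x y \<le> C * y\<^sup>2 + K))"
    using assms(14)
  proof
    assume *: "unif_limsup_le (Gamma_set \<alpha> \<beta>) (\<lambda>t x y. y * f1 t x y / \<bar>y\<bar> ^ 3) c \<and>
            (\<forall>(t, x)\<in>Gamma_set \<alpha> \<beta>. antimono (\<lambda>y. f2 t x y))"
    show thesis
      by (rule one_sided_quadratic_growth[OF cont assms(2) range assms(11) conjunct1[OF *] conjunct2[OF *]],
          assumption+, rule that, assumption+, auto)
  next
    assume *: "unif_liminf_ge (Gamma_set \<alpha> \<beta>) (\<lambda>t x y. y * f1 t x y / \<bar>y\<bar> ^ 3) (\<lambda>t. - c t) \<and>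
            (\<forall>(t, x)\<in>Gamma_set \<alpha> \<beta>. mono (\<lambda>y. f2 t x y))"
    \<comment> \<open>The second condition for \<open>f\<close>, \<open>f1\<close>,
      \<open>f2\<close> is the first one for their negatives, with the same
      \<open>c\<close>.\<close>
    have cont': "continuous_on ({0..1} \<times> UNIV) (\<lambda>(t, x, y). - f t x y)"
      using continuous_on_minus[OF cont] by (simp add: split_def)
    have sum': "- f t x y = - f1 t x y + - f2 t x y" if "t \<in> {0..1}" for t x y
      using assms(2)[OF that] by simp
    have limsup': "unif_limsup_le (Gamma_set \<alpha> \<beta>) (\<lambda>t x y. y * - f1 t x y / \<bar>y\<bar> ^ 3) c"
      unfolding unif_limsup_le_def
    proof (intro allI impI)
      fix \<epsilon> :: real assume "\<epsilon> > 0"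
      then obtain y0 where y0: "y0 > 0"
        "\<forall>(t, x)\<in>Gamma_set \<alpha> \<beta>. \<forall>y. \<bar>y\<bar> > y0 \<longrightarrow> y * f1 t x y / \<bar>y\<bar> ^ 3 \<ge> - c t - \<epsilon>"
        using * unfolding unif_liminf_ge_def by blast
      have "y * - f1 t x y / \<bar>y\<bar> ^ 3 \<le> c t + \<epsilon>" if "(t, x) \<in> Gamma_set \<alpha> \<beta>" "\<bar>y\<bar> > y0" for t x y
        using bspec[OF y0(2) that(1)] that(2) by (auto dest!: spec[of _ y])
      then show "\<exists>y0>0. \<forall>(t, x)\<in>Gamma_set \<alpha> \<beta>. \<forall>y. \<bar>y\<bar> > y0 \<longrightarrow> y * - f1 t x y / \<bar>y\<bar> ^ 3 \<le> c t + \<epsilon>"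
        using y0(1) by auto
    qed
    have anti': "\<forall>(t, x)\<in>Gamma_set \<alpha> \<beta>. antimono (\<lambda>y. - f2 t x y)"
      using * by (auto simp: antimono_def mono_def)
    show thesis
    proof (rule one_sided_quadratic_growth[OF cont' sum' range assms(11) limsup' anti'])
      fix C K :: real
      assume CK: "C > 0" "K > 0"
        and up: "\<And>t x y. (t, x) \<in> Gamma_set \<alpha> \<beta> \<Longrightarrow> y > 0 \<Longrightarrow> - f t x y \<le> C * y\<^sup>2 + K"
        and lo: "\<And>t x y. (t, x) \<in> Gamma_set \<alpha> \<beta> \<Longrightarrow> y < 0 \<Longrightarrow> - (C * y\<^sup>2 + K) \<le> - f t x y"
      have "- (C * y\<^sup>2 + K) \<le> f t x y" if "(t, x) \<in> Gamma_set \<alpha> \<beta>" "y > 0" for t x y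
        using up[OF that] by linarith
      moreover have "f t x y \<le> C * y\<^sup>2 + K" if "(t, x) \<in> Gamma_set \<alpha> \<beta>" "y < 0" for t x y
        using lo[OF that] by linarith
      ultimately show thesis using that[OF CK] by blast
    qed
  qed
  \<comment> \<open>\<open>R\<close> is fixed before the solution is known, from the strip and the
    growth constants alone. Since R \<ge> 1 and R \<ge> E, also R^2 \<ge> E, which is the Nagumo
    condition; the remaining summands dominate |\<alpha>'| and |\<beta>'|.\<close>
  define E where "E = K * exp (2 * C * (B - - A)) / C"
  define R where "R = 1 + E + \<bar>A'\<bar> + \<bar>B'\<bar>"
  have "E \<ge> 0" using CK by (simp add: E_def)
  then have R: "R > 0" "R \<ge> 1" "E \<le> R" "A' \<le> R" "B' \<le> R" by (auto simp: R_def)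
  have "E \<le> R\<^sup>2" using R(3) power_increasing[of 1 2 R] R(2) by simp
  then have ER: "K * exp (2 * C * (B - - A)) \<le> C * R\<^sup>2"
    using CK by (simp add: E_def pos_divide_le_eq mult.commute)
  obtain x v where per: "x 0 = x 1" "v 0 = v 1"
    and between: "\<And>t. t \<in> {0..1} \<Longrightarrow> \<alpha> t \<le> x t \<and> x t \<le> \<beta> t"
    and dx: "\<And>t. t \<in> {0..1} \<Longrightarrow> (x has_real_derivative v t) (at t within {0..1})"
    and dv: "\<And>t. t \<in> {0..1} \<Longrightarrow>
      (v has_real_derivative - f t (x t) (max (- R) (min R (v t)))) (at t within {0..1})"
  proof (rule truncated_bvp[OF cont assms(3,4,5)])
    show "\<bar>deriv01 \<alpha> t\<bar> \<le> R" "\<bar>deriv01 \<beta> t\<bar> \<le> R" if "t \<in> {0..1}" for t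
      using AB'[THEN bspec, OF that] R by linarith+
  qed (use assms(6,7) in auto)
  have xrange: "- A \<le> x t \<and> x t \<le> B" if "t \<in> {0..1}" for t
    using between[OF that] range[OF that] by linarith
  have \<Gamma>: "(t, x t) \<in> Gamma_set \<alpha> \<beta>" if "t \<in> {0..1}" for t
    using between[OF that] that by (simp add: Gamma_set_def)
  define q where "q = (\<lambda>y. max (- R) (min R y))"
  have dvq: "(v has_real_derivative - f t (x t) (q (v t))) (at t within {0..1})" if "t \<in> {0..1}" for t
    unfolding q_def by (rule dv[OF that])
  \<comment> \<open>The cutoff keeps signs and does not increase absolute values, so the growth
    bounds at \<open>q (v s)\<close> imply those in terms of \<open>v s\<close> and the Nagumo
    estimate applies to the truncated equation.\<close>
  have qpos: "q y > 0" if "y > 0" for y using R that by (simp add: q_def)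
  have qneg: "q y < 0" if "y < 0" for y using R that by (simp add: q_def)
  have "(q y)\<^sup>2 \<le> y\<^sup>2" for y
    unfolding abs_le_square_iff[symmetric] using R by (auto simp: q_def)
  then have qsq: "C * (q y)\<^sup>2 \<le> C * y\<^sup>2" for y using CK by simp
  have vR: "\<bar>v t\<bar> < R" if t: "t \<in> {0..1}" for t
    using growth
  proof
    assume g: "\<forall>(t, x)\<in>Gamma_set \<alpha> \<beta>. \<forall>y. (y > 0 \<longrightarrow> f t x y \<le> C * y\<^sup>2 + K)
                    \<and> (y < 0 \<longrightarrow> - (C * y\<^sup>2 + K) \<le> f t x y)"
    show ?thesis
    proof (rule derivative_bound[OF CK R(1) ER dx dvq per xrange _ _ t])
      fix s :: real assume s: "s \<in> {0..1}"
      note gs = spec[OF bspec[OF g \<Gamma>[OF s], unfolded prod.case], of "q (v s)"]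
      show "- (C * (v s)\<^sup>2 + K) \<le> - f s (x s) (q (v s))" if "v s > 0"
        using gs qpos[OF that] qsq[of "v s"] by auto
      show "- f s (x s) (q (v s)) \<le> C * (v s)\<^sup>2 + K" if "v s < 0"
        using gs qneg[OF that] qsq[of "v s"] by auto
    qed
  next
    assume g: "\<forall>(t, x)\<in>Gamma_set \<alpha> \<beta>. \<forall>y. (y > 0 \<longrightarrow> - (C * y\<^sup>2 + K) \<le> f t x y)
                    \<and> (y < 0 \<longrightarrow> f t x y \<le> C * y\<^sup>2 + K)"
    show ?thesis
    proof (rule derivative_bound_reversed[OF CK R(1) ER dx dvq per xrange _ _ t])
      fix s :: real assume s: "s \<in> {0..1}"
      note gs = spec[OF bspec[OF g \<Gamma>[OF s], unfolded prod.case], of "q (v s)"]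
      show "- f s (x s) (q (v s)) \<le> C * (v s)\<^sup>2 + K" if "v s > 0"
        using gs qpos[OF that] qsq[of "v s"] by auto
      show "- (C * (v s)\<^sup>2 + K) \<le> - f s (x s) (q (v s))" if "v s < 0"
        using gs qneg[OF that] qsq[of "v s"] by auto
    qed
  qed
  have "max (- R) (min R (v t)) = v t" if "t \<in> {0..1}" for t
    using vR[OF that] by auto
  then have "(v has_real_derivative - f t (x t) (v t)) (at t within {0..1})" if "t \<in> {0..1}" for t
    using dv[OF that] that by simp
  then have "periodic_solution f x"
    by (intro periodic_solutionI[OF dx _ cont per])
  with between show ?thesis by blast
qed

end
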